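(* Let $R$ be a p.q.-Baer $*$-ring. Then $R$ is a lattice with respect to Conrad's partial order if and only if $aC(b)=bC(a)$ for all $a,b\in R$.
   Context: A $*$-ring is an (associative) ring $R$ with an involution $x\mapsto x^*$, i.e. an additive anti-automorphism with $(x^* )^*=x$. A projection is an element $e\in R$ with $e=e^2=e^*$. A $*$-ring $R$ is a p.q.-Baer $*$-ring if for every $a\in R$ there is a projection $e\in R$ with $r_R(aR)=eR$, where $r_R(B)=\{x\in R : bx=0 \text{ for every } b\in B\}$. (Such a ring automatically has an identity element and is semiprime.) Conrad's partial order on $R$: $a\leq b$ if and only if $arb=ara$ for all $r\in R$; this is a partial order on every p.q.-Baer $*$-ring. The central cover $C(x)$ of $x\in R$ is the smallest central projection $h$ with $hx=x$ (central projections being ordered by $e\leq f \iff e=ef$); it is known that every element of a p.q.-Baer $*$-ring has a central cover. *)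

theory Defs
  imports Main
begin

text \<open>The class \<^class>\<open>ring\<close> is that of associative rings, not necessarily with identity.\<close>

locale star_ring =
  fixes star :: "'a::ring \<Rightarrow> 'a"
  assumes star_add: "star (x + y) = star x + star y"
    and star_mult: "star (x * y) = star y * star x"
    and star_star: "star (star x) = x"
begin

definition projection :: "'a \<Rightarrow> bool" where
  "projection e \<longleftrightarrow> e = e * e \<and> e = star e"

definition central_projection :: "'a \<Rightarrow> bool" where
  "central_projection e \<longleftrightarrow> projection e \<and> (\<forall>x. e * x = x * e)"

text \<open>\<open>is_central_cover x h\<close>: \<open>h\<close> is the smallest central projection with \<open>h * x = x\<close>,
  where \<open>e \<le> f\<close> means \<open>e = e * f\<close>.\<close>

definition is_central_cover :: "'a \<Rightarrow> 'a \<Rightarrow> bool" where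
  "is_central_cover x h \<longleftrightarrow> central_projection h \<and> h * x = x \<and>
     (\<forall>g. central_projection g \<and> g * x = x \<longrightarrow> h = h * g)"

definition central_cover :: "'a \<Rightarrow> 'a" where
  "central_cover x = (THE h. is_central_cover x h)"

lemma is_central_cover_unique:
  assumes "is_central_cover x h" "is_central_cover x h'"
  shows "h = h'"
proof -
  have "h = h * h'" "h' = h' * h" "h * h' = h' * h"
    using assms unfolding is_central_cover_def central_projection_def by blast+
  then show ?thesis by simp
qed

end

definition right_annihilator :: "'a::ring set \<Rightarrow> 'a set" where
  "right_annihilator B = {x. \<forall>b\<in>B. b * x = 0}"

definition right_multiples :: "'a::ring \<Rightarrow> 'a set" where
  "right_multiples a = {a * x | x. True}"

locale pq_baer_star_ring = star_ring +
  assumes right_annihilator_right_multiples: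
    "\<exists>e. projection e \<and> right_annihilator (right_multiples a) = right_multiples e"
begin

lemma ex_identity: "\<exists>u::'a. \<forall>x. u * x = x \<and> x * u = x"
proof -
  obtain e where e: "projection e"
    "right_annihilator (right_multiples 0) = right_multiples e"
    using right_annihilator_right_multiples by blast
  have L: "e * x = x" for x
  proof -
    have "x \<in> right_multiples e"
      using e(2) by (auto simp: right_annihilator_def right_multiples_def)
    then obtain y where "x = e * y" by (auto simp: right_multiples_def)
    then show ?thesis using e(1) by (metis mult.assoc projection_def)
  qed
  have "x * e = x" for x
    using L[of "star x"] e(1) by (metis projection_def star_mult star_star)
  with L show ?thesis by blast
qed

lemma ex_is_central_cover: "\<exists>h. is_central_cover x h"
proof -
  obtain u :: 'a where u: "u * y = y" "y * u = y" for y using ex_identity by blast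
  have star_u: "star u = u" using u[of "star u"] star_mult[of "star u" u] star_star[of u] by simp
  obtain e where e: "projection e"
    "right_annihilator (right_multiples x) = right_multiples e"
    using right_annihilator_right_multiples by blast
  have ee: "e * e = e" and se: "star e = e" using e(1) by (auto simp: projection_def)
  have ann: "(\<forall>r. x * r * y = 0) \<longleftrightarrow> e * y = y" for y
  proof -
    have "(\<forall>r. x * r * y = 0) \<longleftrightarrow> y \<in> right_annihilator (right_multiples x)"
      by (auto simp: right_annihilator_def right_multiples_def)
    also have "\<dots> \<longleftrightarrow> (\<exists>z. y = e * z)" unfolding e(2) by (auto simp: right_multiples_def)
    also have "\<dots> \<longleftrightarrow> e * y = y" using ee by (metis mult.assoc)
    finally show ?thesis .
  qed
  have ere: "e * (r * e) = r * e" for r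
  proof -
    have "\<forall>s. x * s * e = 0" using ann[of e] ee by simp
    then have "\<forall>s. x * s * (r * e) = 0" by (metis mult.assoc)
    then show ?thesis using ann by blast
  qed
  have comm: "e * r = r * e" for r
  proof -
    have "star (e * (star r * e)) = star (star r * e)" using ere by simp
    then have "e * r * e = e * r" by (simp add: star_mult star_star se)
    then show ?thesis using ere[of r] by (simp add: mult.assoc)
  qed
  have star_diff: "star (a - b) = star a - star b" for a b
    using star_add[of "a - b" b] by (simp add: eq_diff_eq)
  have "\<forall>r. x * r * e = 0" using ann[of e] ee by simp
  then have "x * u * e = 0" by blast
  then have hx: "(u - e) * x = x" by (simp add: left_diff_distrib u comm[of x])
  have cp: "central_projection (u - e)"
    unfolding central_projection_def projection_def
  proof (intro conjI allI)
    show "u - e = (u - e) * (u - e)" by (simp add: left_diff_distrib right_diff_distrib u ee)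
    show "u - e = star (u - e)" by (simp add: star_diff star_u se)
    show "(u - e) * r = r * (u - e)" for r
      by (simp add: left_diff_distrib right_diff_distrib u comm[of r])
  qed
  have "u - e = (u - e) * g" if g: "central_projection g" "g * x = x" for g
  proof -
    have gc: "g * y = y * g" for y using g(1) by (simp add: central_projection_def)
    have "x * r * (u - g) = 0" for r
      proof -
      have "x * r * g = g * x * r" using gc[of "x * r"] by (simp add: mult.assoc)
      then show ?thesis using g(2) by (simp add: right_diff_distrib u)
    qed
    then have "e * (u - g) = u - g" using ann by blast
    then have "u - e = g - e * g" by (simp add: u algebra_simps)
    moreover have "(u - e) * g = g - e * g" by (simp add: left_diff_distrib u)
    ultimately show ?thesis by (rule trans[OF _ sym])
  qed
  with hx cp show ?thesis unfolding is_central_cover_def by blast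
qed

lemma is_central_cover_central_cover: "is_central_cover x (central_cover x)"
  unfolding central_cover_def
  using ex_is_central_cover is_central_cover_unique by (metis theI)

end

definition conrad_le :: "'a::ring \<Rightarrow> 'a \<Rightarrow> bool" where
  "conrad_le a b \<longleftrightarrow> (\<forall>r. a * r * b = a * r * a)"

text \<open>The predicate \<^const>\<open>class.lattice\<close> takes the meet, the order, its strict part and the join;
  it includes the axioms of a partial order.\<close>

definition is_lattice :: "('a \<Rightarrow> 'a \<Rightarrow> bool) \<Rightarrow> bool" where
  "is_lattice le \<longleftrightarrow>
     (\<exists>meet join. class.lattice meet le (\<lambda>a b. le a b \<and> \<not> le b a) join)"

end

theory Submission
  imports Defs
begin

text \<open>Since \<open>a R y = 0\<close> forces \<open>C(a)y = 0\<close>, the relation \<open>a \<le> b\<close> implies \<open>C(a)b = a\<close>. If \<open>a\<close> and \<open>b\<close> have an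
  upper bound \<open>c\<close>, then \<open>a C(b) = C(a)C(b)c = b C(a)\<close>. Conversely, the identity with \<open>b = 1\<close> says
  \<open>a = C(a)\<close>, so every element is a central projection: \<open>R\<close> is a Boolean ring, on which
  Conrad's order is the Boolean order, with meet \<open>ab\<close> and join \<open>a + b - ab\<close>.\<close>

lemma is_lattice_conrad_le_if_idempotent_commute:
  assumes idem: "\<And>x::'a::ring. x * x = x" and comm: "\<And>x y::'a. x * y = y * x"
  shows "is_lattice (conrad_le :: 'a \<Rightarrow> 'a \<Rightarrow> bool)"
proof -
  have left_idem: "x * (x * y) = x * y" for x y :: 'a
    by (metis idem mult.assoc)
  have le: "conrad_le a b \<longleftrightarrow> a * b = a" for a b :: 'a
  proof
    assume "conrad_le a b"
    \<comment> \<open>The instance \<open>r = a\<close>, where idempotence collapses both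
      sides.\<close>
    then have "a * a * b = a * a * a" by (simp add: conrad_le_def)
    then show "a * b = a" by (simp add: idem)
  next
    assume "a * b = a"
    then have "a * r * b = a * r * a" for r
      by (simp add: comm[of a r] idem mult.assoc)
    then show "conrad_le a b" by (simp add: conrad_le_def)
  qed
  have "class.lattice (*) conrad_le (\<lambda>a b::'a. conrad_le a b \<and> \<not> conrad_le b a)
    (\<lambda>a b. a + b - a * b)"
  \<comment> \<open>Rewriting with \<open>le\<close> turns the order and lattice axioms into
    equations between products; reflexivity and the strict part are left to the closing
    \<open>auto\<close>.\<close>
  proof (unfold_locales, unfold le)
    show "x * z = x" if "x * y = x" "y * z = y" for x y z :: 'a
      using that by (metis mult.assoc)
    show "x = y" if "x * y = x" "y * x = y" for x y :: 'a
      using that comm by metis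
    show "x * (y * z) = x" if "x * y = x" "x * z = x" for x y z :: 'a
      using that by (metis mult.assoc)
    show "(y + z - y * z) * x = y + z - y * z" if "y * x = y" "z * x = z" for x y z :: 'a
      using that by (simp add: left_diff_distrib distrib_right mult.assoc)
    show "x * y * x = x * y" for x y :: 'a
      using left_idem[of x y] by (simp add: comm[of "x * y" x])
    show "x * y * y = x * y" for x y :: 'a
      by (simp add: idem mult.assoc)
    show "x * (x + y - x * y) = x" for x y :: 'a
      by (simp add: idem left_idem distrib_left right_diff_distrib)
    show "y * (x + y - x * y) = y" for x y :: 'a
      using left_idem[of y x] by (simp add: idem comm[of x y] distrib_left right_diff_distrib)
  qed (auto simp: idem)
  then show ?thesis unfolding is_lattice_def by blast
qed

context pq_baer_star_ring
begin

lemma central_projection_central_cover: "central_projection (central_cover x)"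
  and central_cover_mult_self: "central_cover x * x = x"
  and central_cover_least:
    "central_projection g \<Longrightarrow> g * x = x \<Longrightarrow> central_cover x = central_cover x * g"
  using is_central_cover_central_cover[of x] unfolding is_central_cover_def by blast+

lemma central_cover_commute: "central_cover x * y = y * central_cover x"
  using central_projection_central_cover unfolding central_projection_def by blast

text \<open>The right annihilator of \<open>a * R\<close> is generated by a projection
  \<open>e\<close> that turns out to be central. With \<open>u\<close> the identity,
  \<open>u - e\<close> is then a central projection fixing \<open>a\<close>, so
  \<open>central_cover a\<close> lies below it by minimality; and \<open>u - e\<close> kills
  \<open>y\<close> because \<open>e * y = y\<close>.\<close>

lemma central_cover_mult_eq_zero:
  assumes "\<And>r. a * r * y = 0"
  shows "central_cover a * y = 0"
proof -
  obtain u :: 'a where u: "\<And>x. u * x = x" "\<And>x. x * u = x"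
    using ex_identity by blast
  obtain e where e: "projection e"
    "right_annihilator (right_multiples a) = right_multiples e"
    using right_annihilator_right_multiples by blast
  have ee: "e * e = e" and se: "star e = e" using e(1) by (auto simp: projection_def)
  have ann: "(\<forall>r. a * r * z = 0) \<longleftrightarrow> e * z = z" for z
  proof -
    have "(\<forall>r. a * r * z = 0) \<longleftrightarrow> z \<in> right_annihilator (right_multiples a)"
      by (auto simp: right_annihilator_def right_multiples_def)
    also have "\<dots> \<longleftrightarrow> (\<exists>w. z = e * w)" unfolding e(2) by (auto simp: right_multiples_def)
    also have "\<dots> \<longleftrightarrow> e * z = z" using ee by (metis mult.assoc)
    finally show ?thesis .
  qed
  \<comment> \<open>The annihilator is also a left ideal, as
    \<open>a * s * (r * e) = a * (s * r) * e = 0\<close>; hence it contains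
    \<open>r * e\<close>.\<close>
  have ere: "e * (r * e) = r * e" for r
  proof -
    have "a * s * (r * e) = 0" for s
      using ann[of e] ee mult.assoc[of a s r] mult.assoc[of "a * s" r e] by simp
    then show ?thesis using ann by blast
  qed
  have comm: "e * r = r * e" for r
  proof -
    \<comment> \<open>Applying \<open>star\<close> to \<open>ere\<close> for \<open>star r\<close>
      gives the mirror image \<open>e * r * e = e * r\<close>; together with \<open>ere\<close> for
      \<open>r\<close> this is centrality.\<close>
    have "star (e * (star r * e)) = star (star r * e)" using ere by simp
    then have "e * r * e = e * r" by (simp add: star_mult star_star se)
    then show ?thesis using ere[of r] by (simp add: mult.assoc)
  qed
  have star_u: "star u = u"
    using u(1)[of "star u"] u(2)[of "star u"] star_mult[of "star u" u] star_star[of u] by simp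
  have star_diff: "star (x - z) = star x - star z" for x z
    using star_add[of "x - z" z] by (simp add: eq_diff_eq)
  have "central_projection (u - e)"
    unfolding central_projection_def projection_def
  proof (intro conjI allI)
    show "u - e = (u - e) * (u - e)" by (simp add: left_diff_distrib right_diff_distrib u ee)
    show "u - e = star (u - e)" by (simp add: star_diff star_u se)
    show "(u - e) * r = r * (u - e)" for r
      by (simp add: left_diff_distrib right_diff_distrib u comm[of r])
  qed
  moreover have "(u - e) * a = a"
  proof -
    \<comment> \<open>Since \<open>e\<close> itself lies in the annihilator, \<open>r = u\<close>
      yields \<open>a * e = 0\<close>.\<close>
    have "a * u * e = 0" using ann[of e] ee by blast
    then show ?thesis by (simp add: left_diff_distrib u comm[of a])
  qed
  ultimately have "central_cover a = central_cover a * (u - e)"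
    by (rule central_cover_least)
  moreover have "(u - e) * y = 0"
    using ann[of y] assms by (simp add: left_diff_distrib u)
  ultimately show ?thesis by (metis mult.assoc mult_zero_right)
qed

lemma conrad_le_imp_central_cover_mult:
  assumes "conrad_le a b"
  shows "central_cover a * b = a"
proof -
  \<comment> \<open>Conrad's order is an annihilator condition on the difference
    \<open>b - a\<close>.\<close>
  have "a * r * (b - a) = 0" for r
    using assms by (simp add: conrad_le_def right_diff_distrib)
  then have "central_cover a * (b - a) = 0" by (rule central_cover_mult_eq_zero)
  then show ?thesis by (simp add: right_diff_distrib central_cover_mult_self)
qed

lemma mult_central_cover_eq_if_bounded:
  assumes "conrad_le a c" "conrad_le b c"
  shows "a * central_cover b = b * central_cover a"
proof -
  \<comment> \<open>Replace \<open>a\<close> by \<open>central_cover a * c\<close>, then move the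
    central element \<open>central_cover b\<close> past \<open>c\<close>.\<close>
  have "a * central_cover b = central_cover a * (central_cover b * c)"
    using assms(1)[THEN conrad_le_imp_central_cover_mult] central_cover_commute[of b c]
    by (simp flip: mult.assoc)
  also have "\<dots> = central_cover a * b"
    using assms(2)[THEN conrad_le_imp_central_cover_mult] by simp
  finally show ?thesis by (simp add: central_cover_commute)
qed

lemma central_projection_if_mult_central_cover_eq:
  assumes "\<And>a b. a * central_cover b = b * central_cover a"
  shows "central_projection x"
proof -
  obtain u :: 'a where u: "\<And>x. u * x = x" "\<And>x. x * u = x"
    using ex_identity by blast
  \<comment> \<open>Only the identity can act on \<open>u\<close> as the identity, so the hypothesis
    at \<open>u\<close> reads \<open>x * u = u * central_cover x\<close>.\<close>
  have "central_cover u = u" using central_cover_mult_self[of u] u by simp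
  then have "x = central_cover x" using assms[of x u] u by simp
  then show ?thesis using central_projection_central_cover by metis
qed

end

theorem theorem3p10:
  fixes star :: "'a::ring \<Rightarrow> 'a"
  assumes "pq_baer_star_ring star"
  shows "is_lattice (conrad_le :: 'a \<Rightarrow> 'a \<Rightarrow> bool) \<longleftrightarrow>
    (\<forall>a b. a * star_ring.central_cover star b = b * star_ring.central_cover star a)"
proof -
  interpret pq_baer_star_ring star by (fact assms)
  show ?thesis
  proof
    assume "is_lattice (conrad_le :: 'a \<Rightarrow> 'a \<Rightarrow> bool)"
    then obtain meet join where "class.lattice meet (conrad_le :: 'a \<Rightarrow> 'a \<Rightarrow> bool)
        (\<lambda>a b. conrad_le a b \<and> \<not> conrad_le b a) join"
      unfolding is_lattice_def by blast
    then interpret L: lattice meet "conrad_le :: 'a \<Rightarrow> 'a \<Rightarrow> bool"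
      "\<lambda>a b. conrad_le a b \<and> \<not> conrad_le b a" join .
    \<comment> \<open>The common upper bound of \<open>a\<close> and \<open>b\<close> is
      \<open>join a b\<close>.\<close>
    show "\<forall>a b. a * central_cover b = b * central_cover a"
      using mult_central_cover_eq_if_bounded L.sup_ge1 L.sup_ge2 by blast
  next
    assume "\<forall>a b. a * central_cover b = b * central_cover a"
    then have "central_projection x" for x
      using central_projection_if_mult_central_cover_eq by blast
    then show "is_lattice (conrad_le :: 'a \<Rightarrow> 'a \<Rightarrow> bool)"
      by (intro is_lattice_conrad_le_if_idempotent_commute)
        (simp_all add: central_projection_def projection_def)
  qed
qed

end
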